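(* Let $a\in(0,1]$ and $x^{(0)}\neq0$. Then $x^{(k)}\neq0$ almost surely for every $k$, and with $Z\sim\mathcal N(0,I_d)$, $$\mu_a(\sigma):=\log\sigma+\frac12\mathbb E\big[\log\|\phi_a(Z)\|^2\big],\qquad s_a^2:=\frac14\operatorname{Var}\big(\log\|\phi_a(Z)\|^2\big)$$ are finite, $\frac1k\log\|x^{(k)}\|\to\mu_a(\sigma)$ almost surely as $k\to\infty$ (a deterministic limit independent of $x^{(0)}$), and $$\frac{\log\|x^{(k)}\|-\mu_a(\sigma)k}{\sqrt k}\Rightarrow\mathcal N(0,s_a^2)\quad\text{in distribution as }k\to\infty.$$
   Context: Fix an integer width $d\ge1$ and a parameter $a\in[0,1]$. The parametric ReLU $\phi_a:\mathbb{R}\to\mathbb{R}$ is $\phi_a(z)=z$ for $z>0$ and $\phi_a(z)=az$ for $z\le 0$; it is applied componentwise to vectors ($\phi_0$ is ReLU, $\phi_1$ is the identity). Given $\sigma>0$ and a deterministic input $x^{(0)}\in\mathbb{R}^d$, the layer outputs of the fully connected network with zero biases are $x^{(k+1)}=\phi_a(W^{(k+1)}x^{(k)})$, $k\ge0$, where all entries of all matrices $W^{(1)},W^{(2)},\dots\in\mathbb{R}^{d\times d}$ are i.i.d. $\mathcal{N}(0,\sigma^2)$. $\|\cdot\|$ denotes the Euclidean norm. *)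

theory Defs
  imports "HOL-Probability.Probability"
begin

definition prelu :: "real \<Rightarrow> real \<Rightarrow> real" where
  "prelu a z = (if z > 0 then z else a * z)"

definition prelu_vec :: "real \<Rightarrow> real ^ 'd \<Rightarrow> real ^ 'd" where
  "prelu_vec a v = (\<chi> i. prelu a (v $ i))"

text \<open>Layer outputs: x 0 = x0, x (k+1) = phi_a (W k x k). The weight matrix
  W k here plays the role of W^(k+1) in the paper.\<close>
fun layer :: "real \<Rightarrow> (nat \<Rightarrow> real ^ 'd ^ 'd) \<Rightarrow> real ^ 'd \<Rightarrow> nat \<Rightarrow> real ^ 'd" where
  "layer a W x0 0 = x0"
| "layer a W x0 (Suc k) = prelu_vec a (W k *v layer a W x0 k)"

definition std_gauss_vec :: "(real ^ 'd) measure" where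
  "std_gauss_vec = density lborel (\<lambda>z. \<Prod>i\<in>UNIV. ennreal (std_normal_density (z $ i)))"

definition logsq :: "real \<Rightarrow> real ^ 'd \<Rightarrow> real" where
  "logsq a z = ln ((norm (prelu_vec a z))\<^sup>2)"

definition mu_a :: "real \<Rightarrow> real \<Rightarrow> ('d::finite) itself \<Rightarrow> real" where
  "mu_a a \<sigma> _ = ln \<sigma> + 1/2 * (\<integral>z. logsq a (z :: real ^ 'd) \<partial>std_gauss_vec)"

definition s2_a :: "real \<Rightarrow> ('d::finite) itself \<Rightarrow> real" where
  "s2_a a _ = 1/4 * (\<integral>z. (logsq a (z :: real ^ 'd) - (\<integral>y. logsq a (y :: real ^ 'd) \<partial>std_gauss_vec))\<^sup>2 \<partial>std_gauss_vec)"

end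

theory Submission
  imports Defs
begin

text \<open>
  Since the activation is positively homogeneous, the growth factor of the norm in layer k depends
  only on the weights W k and on the direction u of the current output. For every fixed unit vector u,
  the vector W k u / sigma is standard Gaussian, and W k is independent of u. Hence the vectors
  G k = W k u / sigma are i.i.d. standard Gaussian although the directions u depend on the past, and
  the logarithm of the norm is a random walk with i.i.d. steps ln sigma + logsq a (G k) / 2.
  The steps have finite fourth moments, because the logarithm is dominated by small positive and
  negative powers, so the strong law and the central limit theorem apply.
\<close>

section \<open>Independence from the past\<close>

text \<open>The direction in layer k is a function of all earlier weights, so independence of the
  vectors G k cannot be read off from disjoint blocks of entries. It comes from conditioning:
  whatever the earlier weights were, G k has the same law, hence it is independent of them and of
  every function of them, in particular of the earlier G j. This needs a unit direction for every
  past, even on the null event where a layer vanishes.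

  Fourth moments make the strong law elementary: the fourth moment of S_n / n is of order 1/n^2 and
  summable, while the second moment only gives 1/n. Control of the logarithm near zero comes from a
  > 0 through a ||z|| <= ||phi_a(z)||. The same inequality shows that ||phi_a|| has bounded level
  sets, which yields the positive variance for the central limit theorem.\<close>

text \<open>
  A random variable whose conditional law given X does not depend on X is independent of X.
  Independence is stated on events because the library predicate for independence of two variables
  requires them to have the same type.
\<close>

lemma (in prob_space) indep_var_law_constant:
  assumes indep: "indep_var S X T V"
    and f [measurable]: "(\<lambda>(x, v). f x v) \<in> S \<Otimes>\<^sub>M T \<rightarrow>\<^sub>M N"
    and law: "\<And>x. x \<in> space S \<Longrightarrow> distr M N (\<lambda>\<omega>. f x (V \<omega>)) = Q"
  shows "\<And>A B. A \<in> sets S \<Longrightarrow> B \<in> sets N \<Longrightarrow>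
      prob ((X -` A \<inter> space M) \<inter> ((\<lambda>\<omega>. f (X \<omega>) (V \<omega>)) -` B \<inter> space M))
      = prob (X -` A \<inter> space M) * prob ((\<lambda>\<omega>. f (X \<omega>) (V \<omega>)) -` B \<inter> space M)"
    and "distr M N (\<lambda>\<omega>. f (X \<omega>) (V \<omega>)) = Q"
proof -
  have [measurable]: "random_variable S X" "random_variable T V"
    using indep by (blast dest: indep_var_rv1 indep_var_rv2)+
  have joint: "distr M S X \<Otimes>\<^sub>M distr M T V = distr M (S \<Otimes>\<^sub>M T) (\<lambda>\<omega>. (X \<omega>, V \<omega>))"
    using indep unfolding indep_var_distribution_eq by simp
  interpret P: prob_space "distr M S X" by (rule prob_space_distr) simp
  interpret R: prob_space "distr M T V" by (rule prob_space_distr) simp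
  \<comment> \<open>One point of the nonempty space of X suffices to see that Q is a probability
    measure on the sets of N.\<close>
  obtain x0 where x0: "x0 \<in> space S"
    using not_empty measurable_space[of X M S] by auto
  have meas_f [measurable]: "f x \<in> T \<rightarrow>\<^sub>M N" if "x \<in> space S" for x
    using measurable_Pair2[OF f that] by simp
  have prob_Q: "prob_space Q"
    unfolding law[OF x0, symmetric] using meas_f[OF x0] by (intro prob_space_distr) simp
  interpret Q: prob_space Q by (rule prob_Q)
  have sets_Q [measurable_cong, simp]: "sets Q = sets N"
    unfolding law[OF x0, symmetric] by simp
  \<comment> \<open>Fubini: for fixed x in A the integral over V is Q(B), the same for all x, so the
    joint law of X and f(X, V) is a product on rectangles.\<close>
  have rect: "emeasure (distr M S X) A * emeasure Q B
      = emeasure (distr M (S \<Otimes>\<^sub>M N) (\<lambda>\<omega>. (X \<omega>, f (X \<omega>) (V \<omega>)))) (A \<times> B)"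
    if [measurable]: "A \<in> sets S" "B \<in> sets N" for A B
  proof -
    define E where "E = {p \<in> space (S \<Otimes>\<^sub>M T). fst p \<in> A \<and> f (fst p) (snd p) \<in> B}"
    have E [measurable]: "E \<in> sets (S \<Otimes>\<^sub>M T)" unfolding E_def by measurable
    have "emeasure (distr M (S \<Otimes>\<^sub>M N) (\<lambda>\<omega>. (X \<omega>, f (X \<omega>) (V \<omega>)))) (A \<times> B)
        = emeasure M ((\<lambda>\<omega>. (X \<omega>, f (X \<omega>) (V \<omega>))) -` (A \<times> B) \<inter> space M)"
      by (subst emeasure_distr) auto
    also have "\<dots> = emeasure M ((\<lambda>\<omega>. (X \<omega>, V \<omega>)) -` E \<inter> space M)"
      by (rule arg_cong[where f = "emeasure M"])
        (auto simp: E_def space_pair_measure dest: measurable_space[of X M S, rotated] measurable_space[of V M T, rotated])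
    also have "\<dots> = emeasure (distr M S X \<Otimes>\<^sub>M distr M T V) E"
      unfolding joint by (subst emeasure_distr) auto
    also have "\<dots> = (\<integral>\<^sup>+x. emeasure (distr M T V) (Pair x -` E) \<partial>distr M S X)"
      by (subst R.emeasure_pair_measure_alt) auto
    also have "\<dots> = (\<integral>\<^sup>+x. indicator A x * emeasure Q B \<partial>distr M S X)"
    proof (rule nn_integral_cong)
      fix x assume "x \<in> space (distr M S X)"
      then have x: "x \<in> space S" by simp
      note [measurable] = meas_f[OF x]
      have "Pair x -` E = (if x \<in> A then f x -` B \<inter> space T else {})"
        using x by (auto simp: E_def space_pair_measure)
      moreover have "emeasure (distr M T V) (f x -` B \<inter> space T) = emeasure Q B"
      proof -
        have "emeasure (distr M T V) (f x -` B \<inter> space T)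
            = emeasure (distr (distr M T V) N (f x)) B"
          by (subst emeasure_distr) auto
        also have "distr (distr M T V) N (f x) = Q"
          using law[OF x] by (subst distr_distr) (auto simp: comp_def)
        finally show ?thesis .
      qed
      ultimately show "emeasure (distr M T V) (Pair x -` E) = indicator A x * emeasure Q B"
        by (simp split: split_indicator)
    qed
    also have "\<dots> = emeasure (distr M S X) A * emeasure Q B"
      by (subst nn_integral_multc) auto
    finally show ?thesis by simp
  qed
  \<comment> \<open>The rectangle with A = \<open>space S\<close> identifies Q as the unconditional
    law, so Q(B) in \<open>rect\<close> becomes the probability of the event.\<close>
  show law_Q: "distr M N (\<lambda>\<omega>. f (X \<omega>) (V \<omega>)) = Q"
  proof (rule measure_eqI)
    fix B assume "B \<in> sets (distr M N (\<lambda>\<omega>. f (X \<omega>) (V \<omega>)))"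
    then have B [measurable]: "B \<in> sets N" by simp
    have "emeasure (distr M N (\<lambda>\<omega>. f (X \<omega>) (V \<omega>))) B
        = emeasure (distr M (S \<Otimes>\<^sub>M N) (\<lambda>\<omega>. (X \<omega>, f (X \<omega>) (V \<omega>)))) (space S \<times> B)"
      by (subst (1 2) emeasure_distr)
        (auto intro!: arg_cong[where f = "emeasure M"] dest: measurable_space[of X M S, rotated])
    also have "\<dots> = emeasure Q B"
      using rect[of "space S" B] P.emeasure_space_1 by simp
    finally show "emeasure (distr M N (\<lambda>\<omega>. f (X \<omega>) (V \<omega>))) B = emeasure Q B" .
  qed simp
  fix A B assume AB [measurable]: "A \<in> sets S" "B \<in> sets N"
  have "emeasure M ((X -` A \<inter> space M) \<inter> ((\<lambda>\<omega>. f (X \<omega>) (V \<omega>)) -` B \<inter> space M))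
      = emeasure (distr M (S \<Otimes>\<^sub>M N) (\<lambda>\<omega>. (X \<omega>, f (X \<omega>) (V \<omega>)))) (A \<times> B)"
    by (subst emeasure_distr) (auto intro!: arg_cong[where f = "emeasure M"])
  also have "\<dots> = emeasure M (X -` A \<inter> space M) * emeasure M ((\<lambda>\<omega>. f (X \<omega>) (V \<omega>)) -` B \<inter> space M)"
    unfolding rect[OF AB, symmetric] law_Q[symmetric] by (simp add: emeasure_distr)
  finally show "prob ((X -` A \<inter> space M) \<inter> ((\<lambda>\<omega>. f (X \<omega>) (V \<omega>)) -` B \<inter> space M))
      = prob (X -` A \<inter> space M) * prob ((\<lambda>\<omega>. f (X \<omega>) (V \<omega>)) -` B \<inter> space M)"
    by (simp add: emeasure_eq_measure ennreal_mult[symmetric])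
qed

text \<open>The product formula for a finite index set is proved by removing the largest index b:
  the remaining events form a cylinder in the variables before b, so the hypothesis splits off the
  last factor.\<close>

lemma (in prob_space) indep_vars_of_past:
  fixes Y :: "nat \<Rightarrow> 'a \<Rightarrow> 'b"
  assumes rv: "\<And>k. random_variable N (Y k)"
    and indep: "\<And>k E B. E \<in> sets (PiM {..<k} (\<lambda>_. N)) \<Longrightarrow> B \<in> sets N \<Longrightarrow>
      prob (((\<lambda>\<omega>. \<lambda>j\<in>{..<k}. Y j \<omega>) -` E \<inter> space M) \<inter> (Y k -` B \<inter> space M))
      = prob ((\<lambda>\<omega>. \<lambda>j\<in>{..<k}. Y j \<omega>) -` E \<inter> space M) * prob (Y k -` B \<inter> space M)"
  shows "indep_vars (\<lambda>_. N) Y UNIV"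
proof -
  have prod: "prob (\<Inter>j\<in>J. A j) = (\<Prod>j\<in>J. prob (A j))"
    if "finite J" "J \<noteq> {}" "\<forall>j\<in>J. A j \<in> {Y j -` B \<inter> space M | B. B \<in> sets N}" for J A
    using that
  proof (induction J rule: finite_linorder_max_induct)
    case empty
    then show ?case by simp
  next
    case (insert b J)
    show ?case
    \<comment> \<open>The empty intersection is \<open>UNIV\<close> and not \<open>space M\<close>,
      so singletons are the true base case.\<close>
    proof (cases "J = {}")
      case True
      then show ?thesis by simp
    next
      case False
      from insert.prems have "\<forall>j. \<exists>B. j \<in> insert b J \<longrightarrow> A j = Y j -` B \<inter> space M \<and> B \<in> sets N"
        by blast
      then obtain B where B: "A j = Y j -` B j \<inter> space M" "B j \<in> sets N" if "j \<in> insert b J" for j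
        by metis
      define E where "E = prod_emb {..<b} (\<lambda>_. N) J (\<Pi>\<^sub>E j\<in>J. B j)"
      have J: "J \<subseteq> {..<b}" using insert.hyps by auto
      have E: "E \<in> sets (PiM {..<b} (\<lambda>_. N))"
        unfolding E_def using J insert.hyps B by (intro sets_PiM_I) auto
      have 1: "(\<Inter>j\<in>J. A j) = (\<lambda>\<omega>. \<lambda>j\<in>{..<b}. Y j \<omega>) -` E \<inter> space M"
      proof (rule set_eqI)
        fix \<omega>
        have "\<omega> \<in> (\<Inter>j\<in>J. A j) \<longleftrightarrow> \<omega> \<in> space M \<and> (\<forall>j\<in>J. Y j \<omega> \<in> B j)"
          using B False by auto
        moreover have "(\<lambda>j\<in>{..<b}. Y j \<omega>) \<in> E \<longleftrightarrow> (\<forall>j\<in>J. Y j \<omega> \<in> B j)" if "\<omega> \<in> space M"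
        proof -
          have "(\<lambda>j\<in>{..<b}. Y j \<omega>) \<in> (\<Pi>\<^sub>E j\<in>{..<b}. space N)"
            using measurable_space[OF rv that] by auto
          moreover have "restrict (\<lambda>j\<in>{..<b}. Y j \<omega>) J = (\<lambda>j\<in>J. Y j \<omega>)"
            using J by (auto simp: restrict_def fun_eq_iff)
          ultimately show ?thesis
            by (simp add: E_def prod_emb_def restrict_PiE_iff Pi_iff)
        qed
        ultimately show "\<omega> \<in> (\<Inter>j\<in>J. A j) \<longleftrightarrow> \<omega> \<in> (\<lambda>\<omega>. \<lambda>j\<in>{..<b}. Y j \<omega>) -` E \<inter> space M"
          by auto
      qed
      have 2: "A b = Y b -` B b \<inter> space M" "B b \<in> sets N" using B by auto
      have "prob ((\<Inter>j\<in>J. A j) \<inter> A b) = prob (\<Inter>j\<in>J. A j) * prob (A b)"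
        unfolding 1 2(1) by (rule indep[OF E 2(2)])
      moreover have "prob (\<Inter>j\<in>J. A j) = (\<Prod>j\<in>J. prob (A j))"
        using insert False by auto
      moreover have "b \<notin> J" using J by auto
      ultimately show ?thesis using insert.hyps
        by (simp add: mult.commute Int_commute)
    qed
  qed
  have "indep_sets (\<lambda>i. {Y i -` B \<inter> space M | B. B \<in> sets N}) UNIV"
    by (rule indep_setsI) (use prod measurable_sets[OF rv] in auto)
  then show ?thesis unfolding indep_vars_def2 using rv by auto
qed

section \<open>Strong law under fourth moments\<close>

lemma abs_power_le_one_plus_fourth:
  fixes x :: real assumes "k \<le> 4" shows "\<bar>x\<bar> ^ k \<le> 1 + x ^ 4"
proof (cases "\<bar>x\<bar> \<le> 1")
  case True
  then have "\<bar>x\<bar> ^ k \<le> 1" by (simp add: power_le_one)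
  moreover have "0 \<le> x ^ 4" by simp
  ultimately show ?thesis by linarith
next
  case False
  then have "\<bar>x\<bar> ^ k \<le> \<bar>x\<bar> ^ 4" using assms by (intro power_increasing) auto
  then show ?thesis by simp
qed

lemma (in prob_space) integrable_power_of_fourth:
  fixes X :: "'a \<Rightarrow> real"
  assumes [measurable]: "random_variable borel X" and "integrable M (\<lambda>\<omega>. X \<omega> ^ 4)" "k \<le> 4"
  shows "integrable M (\<lambda>\<omega>. X \<omega> ^ k)"
proof (rule Bochner_Integration.integrable_bound)
  show "integrable M (\<lambda>\<omega>. 1 + X \<omega> ^ 4)" using assms(2) by simp
  show "AE \<omega> in M. norm (X \<omega> ^ k) \<le> norm (1 + X \<omega> ^ 4)"
    using abs_power_le_one_plus_fourth[OF \<open>k \<le> 4\<close>] by (auto simp: power_abs intro: order_trans[OF _ abs_ge_self])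
qed simp

text \<open>By independence every mixed term of the binomial expansion that contains a first power
  has expectation zero; only the product of the squares survives. This is the recursion for the
  moments of partial sums.\<close>

lemma (in prob_space) indep_var_sum_moments:
  fixes X Y :: "'a \<Rightarrow> real"
  assumes indep: "indep_var borel X borel Y"
    and X4: "integrable M (\<lambda>\<omega>. X \<omega> ^ 4)" and Y4: "integrable M (\<lambda>\<omega>. Y \<omega> ^ 4)"
    and X0: "expectation X = 0" and Y0: "expectation Y = 0"
  shows "integrable M (\<lambda>\<omega>. (X \<omega> + Y \<omega>) ^ 4)"
    and "expectation (\<lambda>\<omega>. X \<omega> + Y \<omega>) = 0"
    and "expectation (\<lambda>\<omega>. (X \<omega> + Y \<omega>) ^ 2) = expectation (\<lambda>\<omega>. X \<omega> ^ 2) + expectation (\<lambda>\<omega>. Y \<omega> ^ 2)"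
    and "expectation (\<lambda>\<omega>. (X \<omega> + Y \<omega>) ^ 4) = expectation (\<lambda>\<omega>. X \<omega> ^ 4)
      + 6 * (expectation (\<lambda>\<omega>. X \<omega> ^ 2) * expectation (\<lambda>\<omega>. Y \<omega> ^ 2)) + expectation (\<lambda>\<omega>. Y \<omega> ^ 4)"
proof -
  have rv: "random_variable borel X" "random_variable borel Y"
    using indep by (blast dest: indep_var_rv1 indep_var_rv2)+
  have IX: "integrable M (\<lambda>\<omega>. X \<omega> ^ i)" if "i \<le> 4" for i
    using integrable_power_of_fourth[OF rv(1) X4 that] .
  have IY: "integrable M (\<lambda>\<omega>. Y \<omega> ^ i)" if "i \<le> 4" for i
    using integrable_power_of_fourth[OF rv(2) Y4 that] .
  have ind: "indep_var borel (\<lambda>\<omega>. X \<omega> ^ i) borel (\<lambda>\<omega>. Y \<omega> ^ j)" for i j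
    using indep_var_compose[OF indep, of "\<lambda>x. x ^ i" borel "\<lambda>x. x ^ j" borel] by (simp add: comp_def)
  have I: "integrable M (\<lambda>\<omega>. X \<omega> ^ i * Y \<omega> ^ j)" if "i \<le> 4" "j \<le> 4" for i j
    using indep_var_integrable[OF ind IX IY] that by blast
  have E: "expectation (\<lambda>\<omega>. X \<omega> ^ i * Y \<omega> ^ j) = expectation (\<lambda>\<omega>. X \<omega> ^ i) * expectation (\<lambda>\<omega>. Y \<omega> ^ j)"
    if "i \<le> 4" "j \<le> 4" for i j
    using indep_var_lebesgue_integral[OF ind IX IY] that by blast
  have ex4: "(X \<omega> + Y \<omega>) ^ 4 = X \<omega> ^ 4 + 4 * (X \<omega> ^ 3 * Y \<omega> ^ 1) + 6 * (X \<omega> ^ 2 * Y \<omega> ^ 2)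
      + 4 * (X \<omega> ^ 1 * Y \<omega> ^ 3) + Y \<omega> ^ 4" for \<omega>
    by (simp add: eval_nat_numeral algebra_simps)
  have ex2: "(X \<omega> + Y \<omega>) ^ 2 = X \<omega> ^ 2 + 2 * (X \<omega> ^ 1 * Y \<omega> ^ 1) + Y \<omega> ^ 2" for \<omega>
    by (simp add: eval_nat_numeral algebra_simps)
  note J = IX[of 4] IY[of 4] IX[of 2] IY[of 2] I[of 3 1] I[of 2 2] I[of 1 3] I[of 1 1]
  note F = E[of 3 1] E[of 2 2] E[of 1 3] E[of 1 1]
  show "integrable M (\<lambda>\<omega>. (X \<omega> + Y \<omega>) ^ 4)"
    unfolding ex4 by (intro Bochner_Integration.integrable_add integrable_mult_right J) auto
  show "expectation (\<lambda>\<omega>. X \<omega> + Y \<omega>) = 0"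
    using IX[of 1] IY[of 1] X0 Y0 by simp
  show "expectation (\<lambda>\<omega>. (X \<omega> + Y \<omega>) ^ 2) = expectation (\<lambda>\<omega>. X \<omega> ^ 2) + expectation (\<lambda>\<omega>. Y \<omega> ^ 2)"
    unfolding ex2 using J F X0 Y0 by simp
  show "expectation (\<lambda>\<omega>. (X \<omega> + Y \<omega>) ^ 4) = expectation (\<lambda>\<omega>. X \<omega> ^ 4)
      + 6 * (expectation (\<lambda>\<omega>. X \<omega> ^ 2) * expectation (\<lambda>\<omega>. Y \<omega> ^ 2)) + expectation (\<lambda>\<omega>. Y \<omega> ^ 4)"
    unfolding ex4 using J F X0 Y0 by simp
qed

text \<open>The four claims are proved by a joint induction, since the step for the fourth moment
  uses the mean, the integrability and the linear bound on the second moment of the previous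
  sum.\<close>

lemma (in prob_space) sum_fourth_moment_le:
  fixes X :: "nat \<Rightarrow> 'a \<Rightarrow> real"
  assumes indep: "indep_vars (\<lambda>_. borel) X UNIV"
    and mean: "\<And>n. expectation (X n) = 0"
    and X4: "\<And>n. integrable M (\<lambda>\<omega>. X n \<omega> ^ 4)"
    and D: "\<And>n. expectation (\<lambda>\<omega>. X n \<omega> ^ 2) \<le> D" "\<And>n. expectation (\<lambda>\<omega>. X n \<omega> ^ 4) \<le> D" "1 \<le> D"
  shows "integrable M (\<lambda>\<omega>. (\<Sum>i<n. X i \<omega>) ^ 4) \<and> expectation (\<lambda>\<omega>. \<Sum>i<n. X i \<omega>) = 0
    \<and> expectation (\<lambda>\<omega>. (\<Sum>i<n. X i \<omega>) ^ 2) \<le> n * D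
    \<and> expectation (\<lambda>\<omega>. (\<Sum>i<n. X i \<omega>) ^ 4) \<le> 6 * D\<^sup>2 * (real n)\<^sup>2"
proof (induction n)
  case 0
  then show ?case by simp
next
  case (Suc n)
  let ?S = "\<lambda>\<omega>. \<Sum>i<n. X i \<omega>"
  have "indep_vars (\<lambda>_. borel) X (insert n {..<n})" using indep by (rule indep_vars_subset) simp
  then have ind: "indep_var borel (X n) borel ?S" by (intro indep_vars_sum) auto
  note m = indep_var_sum_moments[OF ind X4 _ mean]
  have S2: "0 \<le> expectation (\<lambda>\<omega>. (?S \<omega>)\<^sup>2)" "0 \<le> expectation (\<lambda>\<omega>. (X n \<omega>)\<^sup>2)" by simp_all
  \<comment> \<open>The fourth moment grows by at most 6 n D^2 + D, and the claimed bound by 6 D^2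
    (2 n + 1). The former is smaller because D <= 6 D^2, which is where 1 <= D enters.\<close>
  have "expectation (\<lambda>\<omega>. (X n \<omega>)\<^sup>2) * expectation (\<lambda>\<omega>. (?S \<omega>)\<^sup>2) \<le> D * (n * D)"
    using Suc D S2 by (intro mult_mono) auto
  moreover have "D \<le> 6 * D\<^sup>2" using mult_mono[of 1 D D D] D(3) by (simp add: power2_eq_square)
  moreover have "0 \<le> real n * D\<^sup>2" by simp
  ultimately show ?case
    using Suc m D(1)[of n] D(2)[of n]
    by (auto simp: add.commute[of _ "X n _"] algebra_simps power2_eq_square)
qed

text \<open>The series of (S_n / n)^4 has finite expectation, being dominated by a multiple of the
  sum of 1/n^2. It is therefore finite almost surely, and its terms tend to zero.\<close>

lemma (in prob_space) strong_law_of_fourth_moments: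
  fixes X :: "nat \<Rightarrow> 'a \<Rightarrow> real"
  assumes indep: "indep_vars (\<lambda>_. borel) X UNIV"
    and mean: "\<And>n. expectation (X n) = 0"
    and X4: "\<And>n. integrable M (\<lambda>\<omega>. X n \<omega> ^ 4)"
    and C: "\<And>n. expectation (\<lambda>\<omega>. X n \<omega> ^ 4) \<le> C"
  shows "AE \<omega> in M. (\<lambda>n. (\<Sum>i<n. X i \<omega>) / real n) \<longlonglongrightarrow> 0"
proof -
  have rv [measurable]: "random_variable borel (X n)" for n
    using indep unfolding indep_vars_def2 by simp
  \<comment> \<open>One constant that is at least 1 and bounds both moments; the second moment is at
    most 1 + C because x^2 <= 1 + x^4.\<close>
  define D where "D = 1 + max C 0"
  have le4: "expectation (\<lambda>\<omega>. X n \<omega> ^ 4) \<le> D" for n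
    using C[of n] by (simp add: D_def)
  have le2: "expectation (\<lambda>\<omega>. X n \<omega> ^ 2) \<le> D" for n
  proof -
    have "expectation (\<lambda>\<omega>. X n \<omega> ^ 2) \<le> expectation (\<lambda>\<omega>. 1 + X n \<omega> ^ 4)"
      using abs_power_le_one_plus_fourth[of 2] X4 integrable_power_of_fourth[OF rv X4, of 2]
      by (intro integral_mono) auto
    also have "\<dots> \<le> D" using X4 C[of n] by (simp add: D_def prob_space)
    finally show ?thesis .
  qed
  let ?S = "\<lambda>n \<omega>. \<Sum>i<n. X i \<omega>"
  note S = sum_fourth_moment_le[OF indep mean X4 le2 le4]
  have D1: "1 \<le> D" by (simp add: D_def)
  let ?g = "\<lambda>n \<omega>. (?S n \<omega> / real n) ^ 4"
  have int: "(\<integral>\<^sup>+\<omega>. ennreal (?g n \<omega>) \<partial>M) \<le> ennreal (6 * D\<^sup>2 * (1 / (real n)\<^sup>2))" for n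
  proof -
    have "(\<integral>\<^sup>+\<omega>. ennreal (?g n \<omega>) \<partial>M) = ennreal (expectation (?g n))"
      using S[of n, OF D1] by (intro nn_integral_eq_integral) (auto simp: power_divide)
    also have "expectation (?g n) = expectation (\<lambda>\<omega>. ?S n \<omega> ^ 4) / real n ^ 4"
      by (simp add: power_divide)
    also have "\<dots> \<le> 6 * D\<^sup>2 * (real n)\<^sup>2 / real n ^ 4"
      using S[of n, OF D1] by (intro divide_right_mono) auto
    \<comment> \<open>For n = 0 both sides are 0, as division by zero gives zero.\<close>
    also have "\<dots> = 6 * D\<^sup>2 * (1 / (real n)\<^sup>2)"
      by (cases "n = 0") (auto simp: field_simps eval_nat_numeral)
    finally show ?thesis by (simp add: ennreal_leI)
  qed
  have "summable (\<lambda>n. 6 * D\<^sup>2 * (1 / (real n)\<^sup>2))"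
    using inverse_power_summable[of 2, where 'a = real] by (intro summable_mult) (simp add: inverse_eq_divide)
  then have fin: "(\<Sum>n. ennreal (6 * D\<^sup>2 * (1 / (real n)\<^sup>2))) < \<infinity>"
    by (subst suminf_ennreal_eq[OF _ summable_sums]) auto
  have "(\<integral>\<^sup>+\<omega>. (\<Sum>n. ennreal (?g n \<omega>)) \<partial>M) = (\<Sum>n. \<integral>\<^sup>+\<omega>. ennreal (?g n \<omega>) \<partial>M)"
    by (rule nn_integral_suminf) measurable
  also have "\<dots> \<le> (\<Sum>n. ennreal (6 * D\<^sup>2 * (1 / (real n)\<^sup>2)))"
    using int by (intro suminf_le) auto
  finally have "(\<integral>\<^sup>+\<omega>. (\<Sum>n. ennreal (?g n \<omega>)) \<partial>M) \<noteq> \<infinity>" using fin by (auto simp: top_unique)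
  then have "AE \<omega> in M. (\<Sum>n. ennreal (?g n \<omega>)) \<noteq> \<infinity>"
    by (intro nn_integral_PInf_AE) measurable
  then show ?thesis
  proof eventually_elim
    case (elim \<omega>)
    then have "summable (\<lambda>n. ?g n \<omega>)"
      by (intro summable_suminf_not_top) auto
    then have "(\<lambda>n. ?g n \<omega>) \<longlonglongrightarrow> 0" by (rule summable_LIMSEQ_zero)
    then have "(\<lambda>n. root 4 \<bar>?g n \<omega>\<bar>) \<longlonglongrightarrow> root 4 \<bar>0\<bar>" by (intro tendsto_intros)
    moreover have "root 4 \<bar>x ^ 4\<bar> = \<bar>x\<bar>" for x :: real
      using real_root_power_cancel[of 4 "\<bar>x\<bar>"] by (simp add: power_abs)
    ultimately have "(\<lambda>n. \<bar>?S n \<omega> / real n\<bar>) \<longlonglongrightarrow> 0" by simp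
    then show ?case by (rule tendsto_rabs_zero_cancel)
  qed
qed

section \<open>Central limit theorem\<close>

text \<open>Seen as a scaled standard normal, N(0, s^2) has at t the characteristic function of the
  standard normal at t * s.\<close>

lemma density_normal_eq_distr:
  assumes "0 < s"
  shows "density lborel (normal_density 0 s) = distr std_normal_distribution borel (\<lambda>x. s * x)"
proof -
  interpret prob_space std_normal_distribution by (rule prob_space_normal_density) simp
  have "distributed std_normal_distribution lborel (\<lambda>x. x) std_normal_density"
    unfolding distributed_def by (auto intro!: distr_id2)
  from normal_density_affine[OF this, of s 0]
  have "distributed std_normal_distribution lborel (\<lambda>x. s * x) (normal_density 0 s)"
    using assms by simp
  from distributed_distr_eq_density[OF this] show ?thesis
    by (metis distr_cong sets_lborel)
qed

text \<open>A Slutsky statement for deterministic shifts. In characteristic functions the shift is a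
  factor \<open>iexp (t * c n)\<close> tending to 1 and the scaling moves t to t * s, so Levy's
  continuity theorem gives the limit. The shift will carry the initial norm.\<close>

lemma (in prob_space) weak_conv_m_affine_std_normal:
  fixes Z :: "nat \<Rightarrow> 'a \<Rightarrow> real"
  assumes [measurable]: "\<And>n. random_variable borel (Z n)"
    and conv: "weak_conv_m (\<lambda>n. distr M borel (Z n)) std_normal_distribution"
    and s: "0 < s" and c: "c \<longlonglongrightarrow> 0"
  shows "weak_conv_m (\<lambda>n. distr M borel (\<lambda>\<omega>. c n + s * Z n \<omega>)) (density lborel (normal_density 0 s))"
proof (rule levy_continuity)
  show "real_distribution (distr M borel (\<lambda>\<omega>. c n + s * Z n \<omega>))" for n
    by (rule real_distribution_distr) simp
  interpret N: prob_space std_normal_distribution by (rule prob_space_normal_density) simp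
  show "real_distribution (density lborel (normal_density 0 s))"
    unfolding density_normal_eq_distr[OF s] by (rule N.real_distribution_distr) simp
  fix t
  have "char (distr M borel (\<lambda>\<omega>. c n + s * Z n \<omega>)) t
      = iexp (t * c n) * char (distr M borel (Z n)) (t * s)" for n
    by (simp add: char_def integral_distr distrib_left exp_add mult_ac)
  moreover have "char (density lborel (normal_density 0 s)) t = char std_normal_distribution (t * s)"
    unfolding density_normal_eq_distr[OF s] by (simp add: char_def integral_distr mult_ac)
  moreover have "(\<lambda>n. char (distr M borel (Z n)) (t * s)) \<longlonglongrightarrow> char std_normal_distribution (t * s)"
    by (rule levy_continuity1[OF _ real_dist_normal_dist conv]) (rule real_distribution_distr, simp)
  moreover have "(\<lambda>n. iexp (t * c n)) \<longlonglongrightarrow> iexp (t * 0)"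
    by (intro tendsto_intros c)
  ultimately show "(\<lambda>n. char (distr M borel (\<lambda>\<omega>. c n + s * Z n \<omega>)) t)
      \<longlonglongrightarrow> char (density lborel (normal_density 0 s)) t"
    using tendsto_mult by fastforce
qed

section \<open>Standard Gaussian vectors\<close>

lemma borel_measurable_vec_nth [measurable]:
  "(\<lambda>z::real ^ 'd. z $ i) \<in> borel_measurable borel"
  by (intro borel_measurable_continuous_onI continuous_intros)

lemma borel_measurable_vecI:
  fixes f :: "'a \<Rightarrow> real ^ 'd"
  assumes "\<And>i. (\<lambda>x. f x $ i) \<in> borel_measurable M"
  shows "f \<in> borel_measurable M"
  using assms by (subst borel_measurable_euclidean_space) (auto simp: Basis_vec_def inner_axis)

text \<open>The product rule for \<open>lborel\<close> is indexed by \<open>Basis\<close>; the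
  injection of i to \<open>axis i 1\<close> carries it over to coordinates.\<close>

lemma nn_integral_lborel_vec_prod:
  fixes f :: "'d::finite \<Rightarrow> real \<Rightarrow> ennreal"
  assumes [measurable]: "\<And>i. f i \<in> borel_measurable borel"
  shows "(\<integral>\<^sup>+z. (\<Prod>i\<in>UNIV. f i ((z :: real ^ 'd) $ i)) \<partial>lborel) = (\<Prod>i\<in>UNIV. \<integral>\<^sup>+x. f i x \<partial>lborel)"
proof -
  have B: "(Basis :: (real ^ 'd) set) = (\<lambda>i. axis i 1) ` UNIV" by (auto simp: Basis_vec_def)
  have inj: "inj (\<lambda>i::'d. axis i (1::real))" by (auto simp: inj_on_def axis_eq_axis)
  define g where "g b = f (inv (\<lambda>i::'d. axis i (1::real)) b)" for b
  have g: "g (axis i 1) = f i" for i unfolding g_def by (simp add: inv_f_f[OF inj])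
  have "(\<integral>\<^sup>+z. (\<Prod>b\<in>Basis. g b ((z :: real ^ 'd) \<bullet> b)) \<partial>lborel) = (\<Prod>b\<in>Basis. \<integral>\<^sup>+x. g b x \<partial>lborel)"
    by (rule nn_integral_lborel_prod) (auto simp: g_def)
  then show ?thesis unfolding B by (simp add: prod.reindex[OF inj] g inner_axis)
qed

lemma sets_std_gauss_vec [simp, measurable_cong]: "sets std_gauss_vec = sets borel"
  and space_std_gauss_vec [simp]: "space std_gauss_vec = UNIV"
  by (simp_all add: std_gauss_vec_def)

text \<open>A product measure is determined by its values on boxes, where the product density
  factorises. The comparison is therefore made on functions, via \<open>vec_nth\<close>, and
  transported back by \<open>vec_lambda\<close>.\<close>

lemma std_gauss_vec_eq_PiM:
  "(std_gauss_vec :: (real ^ 'd) measure)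
    = distr (PiM UNIV (\<lambda>_. std_normal_distribution)) borel vec_lambda"
proof -
  let ?N = "\<lambda>_::'d. std_normal_distribution"
  interpret N: prob_space std_normal_distribution by (rule prob_space_normal_density) simp
  interpret product_prob_space ?N UNIV by standard
  let ?P = "distr (std_gauss_vec :: (real ^ 'd) measure) (PiM UNIV ?N) vec_nth"
  have sets_N: "sets (PiM UNIV ?N) = sets (PiM UNIV (\<lambda>_. borel))"
    by (intro sets_PiM_cong) auto
  have nth [measurable]: "(vec_nth :: real ^ 'd \<Rightarrow> _) \<in> borel \<rightarrow>\<^sub>M PiM UNIV ?N"
    unfolding measurable_cong_sets[OF refl sets_N] by (rule measurable_PiM_single') auto
  have lam [measurable]: "(vec_lambda :: _ \<Rightarrow> real ^ 'd) \<in> PiM UNIV ?N \<rightarrow>\<^sub>M borel"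
    unfolding measurable_cong_sets[OF sets_N refl]
    by (rule borel_measurable_vecI) simp
  have "?P = PiM UNIV ?N"
  proof (rule PiM_eqI)
    fix A :: "'d \<Rightarrow> real set" assume "\<And>i. i \<in> UNIV \<Longrightarrow> A i \<in> sets std_normal_distribution"
    then have A [measurable]: "A i \<in> sets borel" for i by simp
    have meas: "Pi\<^sub>E UNIV A \<in> sets (PiM UNIV ?N)" by (rule sets_PiM_I_finite) auto
    have pre: "vec_nth -` Pi\<^sub>E UNIV A \<in> sets (borel :: (real ^ 'd) measure)"
      using measurable_sets[OF nth meas] by simp
    have "emeasure ?P (Pi\<^sub>E UNIV A) = emeasure std_gauss_vec (vec_nth -` Pi\<^sub>E UNIV A :: (real ^ 'd) set)"
      using meas by (subst emeasure_distr) auto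
    also have "\<dots> = (\<integral>\<^sup>+z. (\<Prod>i\<in>UNIV. ennreal (std_normal_density (z $ i)))
        * indicator (vec_nth -` Pi\<^sub>E UNIV A) z \<partial>lborel)"
      unfolding std_gauss_vec_def using pre by (subst emeasure_density) auto
    also have "\<dots> = (\<integral>\<^sup>+z. (\<Prod>i\<in>UNIV. (\<lambda>x. ennreal (std_normal_density x) * indicator (A i) x) ((z::real ^ 'd) $ i)) \<partial>lborel)"
    proof (intro nn_integral_cong)
      fix z :: "real ^ 'd"
      have "(indicator (vec_nth -` Pi\<^sub>E UNIV A) z :: ennreal) = (\<Prod>i\<in>UNIV. indicator (A i) (z $ i))"
      proof (cases "\<forall>i. z $ i \<in> A i")
        case True
        then show ?thesis by (auto simp: indicator_def)
      next
        case False
        then obtain i where "z $ i \<notin> A i" by auto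
        then have "(\<Prod>i\<in>UNIV. indicator (A i) (z $ i) :: ennreal) = 0"
          by (intro prod_zero) (auto intro!: exI[of _ i])
        then show ?thesis using False by (auto simp: indicator_def)
      qed
      then show "(\<Prod>i\<in>UNIV. ennreal (std_normal_density (z $ i))) * indicator (vec_nth -` Pi\<^sub>E UNIV A) z
          = (\<Prod>i\<in>UNIV. (\<lambda>x. ennreal (std_normal_density x) * indicator (A i) x) (z $ i))"
        by (simp add: prod.distrib)
    qed
    also have "\<dots> = (\<Prod>i\<in>UNIV. \<integral>\<^sup>+x. ennreal (std_normal_density x) * indicator (A i) x \<partial>lborel)"
      by (rule nn_integral_lborel_vec_prod) measurable
    also have "\<dots> = (\<Prod>i\<in>UNIV. emeasure std_normal_distribution (A i))"
      by (intro prod.cong) (auto simp: emeasure_density)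
    finally show "emeasure ?P (Pi\<^sub>E UNIV A) = (\<Prod>i\<in>UNIV. emeasure std_normal_distribution (A i))" .
  qed auto
  then have "distr (PiM UNIV ?N) borel vec_lambda = distr ?P (borel :: (real ^ 'd) measure) vec_lambda" by simp
  also have "\<dots> = distr std_gauss_vec borel (\<lambda>z::real ^ 'd. z)"
    by (subst distr_distr) (auto simp: comp_def)
  also have "\<dots> = std_gauss_vec"
    by (rule distr_id2) simp
  finally show ?thesis by simp
qed

lemma prob_space_std_gauss_vec: "prob_space (std_gauss_vec :: (real ^ 'd) measure)"
proof -
  have "vec_lambda \<in> PiM UNIV (\<lambda>_::'d. std_normal_distribution) \<rightarrow>\<^sub>M (borel :: (real ^ 'd) measure)"
    by (rule borel_measurable_vecI) simp
  then show ?thesis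
    unfolding std_gauss_vec_eq_PiM
    by (intro prob_space.prob_space_distr prob_space_PiM prob_space_normal_density) auto
qed

lemma distr_std_gauss_vec_nth:
  "distr (std_gauss_vec :: (real ^ 'd) measure) borel (\<lambda>z. z $ i) = std_normal_distribution"
proof -
  have [measurable]: "vec_lambda \<in> PiM UNIV (\<lambda>_::'d. std_normal_distribution) \<rightarrow>\<^sub>M (borel :: (real ^ 'd) measure)"
    by (rule borel_measurable_vecI) simp
  have "distr (std_gauss_vec :: (real ^ 'd) measure) borel (\<lambda>z. z $ i)
      = distr (PiM UNIV (\<lambda>_::'d. std_normal_distribution)) std_normal_distribution (\<lambda>f. f i)"
    unfolding std_gauss_vec_eq_PiM by (subst distr_distr) (auto simp: comp_def intro!: distr_cong)
  also have "\<dots> = std_normal_distribution"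
    by (intro distr_PiM_component prob_space_normal_density) auto
  finally show ?thesis .
qed

lemma (in prob_space) distr_eq_std_gauss_vec:
  fixes G :: "'a \<Rightarrow> real ^ 'd"
  assumes indep: "indep_vars (\<lambda>_. borel) (\<lambda>i \<omega>. G \<omega> $ i) UNIV"
    and normal: "\<And>i. distributed M lborel (\<lambda>\<omega>. G \<omega> $ i) std_normal_density"
  shows "distr M borel G = std_gauss_vec"
proof -
  have rv [measurable]: "(\<lambda>\<omega>. G \<omega> $ i) \<in> borel_measurable M" for i
    using indep unfolding indep_vars_def2 by auto
  have law: "distr M borel (\<lambda>\<omega>. G \<omega> $ i) = std_normal_distribution" for i
    using distributed_distr_eq_density[OF normal, of i]
    by (metis distr_cong sets_lborel)
  have "distr M (PiM UNIV (\<lambda>_. borel)) (\<lambda>\<omega>. \<lambda>i\<in>UNIV. G \<omega> $ i) = PiM UNIV (\<lambda>_::'d. std_normal_distribution)"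
    using indep indep_vars_iff_distr_eq_PiM[where I = UNIV and M' = "\<lambda>_. borel" and X = "\<lambda>i \<omega>. G \<omega> $ i"] rv
    by (simp add: law)
  then have "std_gauss_vec = distr (distr M (PiM UNIV (\<lambda>_. borel)) (\<lambda>\<omega>. \<lambda>i\<in>UNIV. G \<omega> $ i)) borel vec_lambda"
    by (simp add: std_gauss_vec_eq_PiM)
  also have "\<dots> = distr M borel G"
    by (subst distr_distr) (auto simp: comp_def restrict_UNIV intro!: borel_measurable_vecI measurable_PiM_single')
  finally show ?thesis by simp
qed

text \<open>Coordinate i uses only row i, so coordinates are independent because rows are disjoint
  blocks of entries. Within a row, a sum of independent normals has the variances (u_j)^2, which add
  up to 1.\<close>

lemma (in prob_space) distr_gauss_matrix_mult_unit:
  fixes W :: "'a \<Rightarrow> real ^ 'd ^ 'd" and u :: "real ^ 'd"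
  assumes indep: "indep_vars (\<lambda>_. borel) (\<lambda>(i, j) \<omega>. W \<omega> $ i $ j) UNIV"
    and normal: "\<And>i j. distributed M lborel (\<lambda>\<omega>. W \<omega> $ i $ j) (normal_density 0 \<sigma>)"
    and \<sigma>: "\<sigma> > 0" and u: "norm u = 1"
  shows "distr M borel (\<lambda>\<omega>. (1 / \<sigma>) *\<^sub>R (W \<omega> *v u)) = std_gauss_vec"
proof (rule distr_eq_std_gauss_vec)
  have nth: "((1 / \<sigma>) *\<^sub>R (W \<omega> *v u)) $ i = (\<Sum>j\<in>UNIV. u $ j / \<sigma> * W \<omega> $ i $ j)" for \<omega> i
    by (simp add: matrix_vector_mult_def sum_distrib_left mult_ac)
  have "indep_vars (\<lambda>i. PiM ({i} \<times> UNIV) (\<lambda>_. borel))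
      (\<lambda>i \<omega>. restrict (\<lambda>p. (case p of (i, j) \<Rightarrow> \<lambda>\<omega>. W \<omega> $ i $ j) \<omega>) ({i} \<times> UNIV)) UNIV"
    by (rule indep_vars_restrict[OF indep]) (auto simp: disjoint_family_on_def)
  then have "indep_vars (\<lambda>_. borel)
      (\<lambda>i \<omega>. (\<lambda>f. \<Sum>j\<in>UNIV. u $ j / \<sigma> * f (i, j))
        (restrict (\<lambda>p. (case p of (i, j) \<Rightarrow> \<lambda>\<omega>. W \<omega> $ i $ j) \<omega>) ({i} \<times> UNIV))) UNIV"
    by (rule indep_vars_compose2[where N = "\<lambda>_. borel"]) measurable
  then show "indep_vars (\<lambda>_. borel) (\<lambda>i \<omega>. ((1 / \<sigma>) *\<^sub>R (W \<omega> *v u)) $ i) UNIV"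
    unfolding nth by simp
next
  fix i
  \<comment> \<open>Terms with u_j = 0 are degenerate, whereas the sum rule for normals asks for
    positive deviations. They are dropped here and restored at the end, as they contribute
    0.\<close>
  define J where "J = {j. u $ j \<noteq> 0}"
  have "u \<noteq> 0" using u by auto
  then have "J \<noteq> {}" by (auto simp: J_def vec_eq_iff)
  have "indep_vars (\<lambda>j. PiM {(i, j)} (\<lambda>_. borel))
      (\<lambda>j \<omega>. restrict (\<lambda>p. (case p of (i, j) \<Rightarrow> \<lambda>\<omega>. W \<omega> $ i $ j) \<omega>) {(i, j)}) J"
    by (rule indep_vars_restrict[OF indep]) (auto simp: disjoint_family_on_def)
  then have "indep_vars (\<lambda>_. borel)
      (\<lambda>j \<omega>. (\<lambda>f. u $ j / \<sigma> * f (i, j))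
        (restrict (\<lambda>p. (case p of (i, j) \<Rightarrow> \<lambda>\<omega>. W \<omega> $ i $ j) \<omega>) {(i, j)})) J"
    by (rule indep_vars_compose2[where N = "\<lambda>_. borel"]) measurable
  then have ind: "indep_vars (\<lambda>_. borel) (\<lambda>j \<omega>. u $ j / \<sigma> * W \<omega> $ i $ j) J"
    by simp
  have "distributed M lborel (\<lambda>\<omega>. u $ j / \<sigma> * W \<omega> $ i $ j) (normal_density 0 \<bar>u $ j\<bar>)" if "j \<in> J" for j
    using normal_density_affine[OF normal \<sigma>, of "u $ j / \<sigma>" 0 i j] that \<sigma>
    by (simp add: J_def)
  then have "distributed M lborel (\<lambda>\<omega>. \<Sum>j\<in>J. u $ j / \<sigma> * W \<omega> $ i $ j)
      (normal_density (\<Sum>j\<in>J. 0) (sqrt (\<Sum>j\<in>J. \<bar>u $ j\<bar>\<^sup>2)))"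
    using \<open>J \<noteq> {}\<close> ind by (intro sum_indep_normal) (auto simp: J_def)
  moreover have "(\<Sum>j\<in>J. \<bar>u $ j\<bar>\<^sup>2) = (\<Sum>j\<in>UNIV. (u $ j)\<^sup>2)"
    by (auto simp: J_def intro!: sum.mono_neutral_cong_left)
  moreover have "sqrt (\<Sum>j\<in>UNIV. (u $ j)\<^sup>2) = 1"
    using u by (simp add: norm_vec_def L2_set_def)
  moreover have "(\<Sum>j\<in>J. u $ j / \<sigma> * W \<omega> $ i $ j) = (\<Sum>j\<in>UNIV. u $ j / \<sigma> * W \<omega> $ i $ j)" for \<omega>
    by (auto simp: J_def intro!: sum.mono_neutral_cong_left)
  ultimately show "distributed M lborel (\<lambda>\<omega>. ((1 / \<sigma>) *\<^sub>R (W \<omega> *v u)) $ i) std_normal_density"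
    by (simp add: matrix_vector_mult_def sum_distrib_left mult_ac)
qed

section \<open>Moments of the logarithmic norm\<close>

text \<open>The bound ln s <= s is applied to s = t^(1/4) for large t and to s = t^(-1/16) for small
  t; 256 = 4^4 and 65536 = 16^4. The exponent -1/4 is chosen because t will be at least (a |z_i|)^2,
  so that the singularity becomes |z_i|^(-1/2), integrable in dimension one.\<close>

lemma ln_power4_le:
  assumes "0 < (t::real)"
  shows "ln t ^ 4 \<le> 256 * t + 65536 * t powr (-1/4)"
proof (cases "1 \<le> t")
  case True
  have "ln t = 4 * ln (t powr (1/4))" using assms by (simp add: ln_powr)
  also have "\<dots> \<le> 4 * t powr (1/4)"
    using ln_le_minus_one[of "t powr (1/4)"] assms by simp
  finally have "ln t ^ 4 \<le> (4 * t powr (1/4)) ^ 4"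
    using True by (intro power_mono) auto
  also have "\<dots> = 256 * t"
    using assms by (simp add: power_mult_distrib powr_realpow[symmetric] powr_powr)
  finally show ?thesis by (simp add: add_increasing2)
next
  case False
  have "- ln t = 16 * ln (t powr (-1/16))" using assms by (simp add: ln_powr)
  also have "\<dots> \<le> 16 * t powr (-1/16)"
    using ln_le_minus_one[of "t powr (-1/16)"] assms by simp
  finally have "(- ln t) ^ 4 \<le> (16 * t powr (-1/16)) ^ 4"
    using False assms by (intro power_mono) auto
  also have "\<dots> = 65536 * t powr (-1/4)"
    using assms by (simp add: power_mult_distrib powr_realpow[symmetric] powr_powr)
  finally show ?thesis using assms by simp
qed

lemma norm_prelu_vec_le:
  assumes "0 < a" "a \<le> 1"
  shows "norm (prelu_vec a z) \<le> norm z"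
proof (rule norm_le_componentwise_cart)
  fix i
  show "norm (prelu_vec a z $ i) \<le> norm (z $ i)"
    using assms mult_right_mono[of a 1 "\<bar>z $ i\<bar>"] by (auto simp: prelu_vec_def prelu_def abs_mult)
qed

text \<open>The quantitative form of a > 0: ReLU sends the whole negative orthant to zero and
  satisfies no such bound with a positive factor.\<close>

lemma norm_prelu_vec_ge:
  assumes "0 < a" "a \<le> 1"
  shows "a * norm z \<le> norm (prelu_vec a z)"
proof -
  have "norm (a *\<^sub>R z) \<le> norm (prelu_vec a z)"
  proof (rule norm_le_componentwise_cart)
    fix i
    show "norm ((a *\<^sub>R z) $ i) \<le> norm (prelu_vec a z $ i)"
      using assms mult_right_mono[of a 1 "\<bar>z $ i\<bar>"] by (auto simp: prelu_vec_def prelu_def abs_mult)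
  qed
  then show ?thesis using assms by simp
qed

lemma prelu_vec_eq_0_iff:
  assumes "0 < a" "a \<le> 1"
  shows "prelu_vec a z = 0 \<longleftrightarrow> z = 0"
  using norm_prelu_vec_le[OF assms, of z] norm_prelu_vec_ge[OF assms, of z] assms
  by (auto simp: mult_le_0_iff)

lemma prelu_vec_scaleR:
  assumes "0 \<le> c"
  shows "prelu_vec a (c *\<^sub>R z) = c *\<^sub>R prelu_vec a z"
  using assms by (auto simp: prelu_vec_def prelu_def vec_eq_iff zero_less_mult_iff)

lemma borel_measurable_prelu_vec [measurable]:
  "(prelu_vec a :: real ^ 'd \<Rightarrow> _) \<in> borel_measurable borel"
  by (rule borel_measurable_vecI) (simp add: prelu_vec_def prelu_def)

lemma borel_measurable_logsq [measurable]:
  "(logsq a :: real ^ 'd \<Rightarrow> _) \<in> borel_measurable borel"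
  unfolding logsq_def[abs_def] by measurable

text \<open>The density is positive everywhere, so the Gaussian and Lebesgue measures have the same
  null sets.\<close>

lemma AE_std_gauss_vec_iff:
  assumes [measurable]: "Measurable.pred borel P"
  shows "(AE z in std_gauss_vec. P (z :: real ^ 'd)) \<longleftrightarrow> (AE z in lborel. P z)"
proof -
  have "(0 :: ennreal) < (\<Prod>i\<in>UNIV. ennreal (std_normal_density (z $ i)))" for z :: "real ^ 'd"
    by (simp add: prod_ennreal normal_density_pos normal_density_nonneg prod_pos)
  then show ?thesis
    unfolding std_gauss_vec_def by (subst AE_density) auto
qed

lemma AE_std_gauss_vec_nonzero: "AE z in std_gauss_vec. (z :: real ^ 'd) \<noteq> 0"
  by (subst AE_std_gauss_vec_iff) (auto intro: AE_lborel_singleton)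

text \<open>On [-1, 1] the density is at most 1 and the power is integrable; outside, the power is
  at most 1 and the density itself dominates.\<close>

lemma integrable_std_normal_inverse_sqrt:
  "integrable std_normal_distribution (\<lambda>x. \<bar>x\<bar> powr (-1/2))"
proof -
  let ?h = "\<lambda>x::real. indicator {0<..1} x *\<^sub>R x powr (-1/2)"
  have "(\<lambda>x::real. x powr (-1/2)) absolutely_integrable_on {0<..1}"
    by (intro nonnegative_absolutely_integrable_1 integrable_on_powr_from_0') auto
  then have h: "integrable lborel ?h"
    unfolding set_integrable_def by (subst (asm) integrable_completion) auto
  then have h': "integrable lborel (\<lambda>x. ?h (- x))"
    using lborel_integrable_real_affine[OF h, of "-1" 0] by simp
  have nd: "integrable lborel std_normal_density" by (rule integrable_normal_density) simp
  have "integrable lborel (\<lambda>x. std_normal_density x * \<bar>x\<bar> powr (-1/2))"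
  proof (rule Bochner_Integration.integrable_bound)
    show "integrable lborel (\<lambda>x. ?h x + ?h (- x) + std_normal_density x)"
      using h h' nd by (intro Bochner_Integration.integrable_add)
    show "AE x in lborel. norm (std_normal_density x * \<bar>x\<bar> powr (-1/2))
        \<le> norm (?h x + ?h (- x) + std_normal_density x)"
    proof (rule AE_I2)
      fix x :: real
      have nonneg: "0 \<le> std_normal_density x" "0 \<le> ?h x" "0 \<le> ?h (- x)" by auto
      have "sqrt (2 * pi) \<ge> 1" using pi_ge_two by simp
      then have le1: "std_normal_density x \<le> 1"
        unfolding std_normal_density_def by (intro mult_le_one) (auto simp: field_simps)
      have "std_normal_density x * \<bar>x\<bar> powr (-1/2) \<le> ?h x + ?h (- x) + std_normal_density x"
      proof (cases "\<bar>x\<bar> \<le> 1")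
        case True
        have "std_normal_density x * \<bar>x\<bar> powr (-1/2) \<le> 1 * \<bar>x\<bar> powr (-1/2)"
          using le1 by (intro mult_right_mono) auto
        \<comment> \<open>At x = 0 both sides are 0, since \<open>0 powr (-1/2)\<close> is 0 and the
          half-open interval excludes 0.\<close>
        also have "\<dots> = ?h x + ?h (- x)"
          using True by (auto simp: indicator_def)
        finally show ?thesis using nonneg(1) by linarith
      next
        case False
        then have "\<bar>x\<bar> powr (-1/2) \<le> 1"
          using powr_mono[of "-1/2" 0 "\<bar>x\<bar>"] by (auto split: if_splits)
        then have "std_normal_density x * \<bar>x\<bar> powr (-1/2) \<le> std_normal_density x * 1"
          using nonneg by (intro mult_left_mono) auto
        then show ?thesis using nonneg by linarith
      qed
      then show "norm (std_normal_density x * \<bar>x\<bar> powr (-1/2))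
          \<le> norm (?h x + ?h (- x) + std_normal_density x)"
        using nonneg by (simp add: abs_mult)
    qed
  qed simp
  then show ?thesis
    by (subst integrable_density) (auto simp: normal_density_nonneg)
qed

lemma integrable_std_gauss_vec_nth:
  fixes f :: "real \<Rightarrow> real"
  assumes "integrable std_normal_distribution f"
  shows "integrable std_gauss_vec (\<lambda>z::real ^ 'd. f (z $ i))"
proof -
  have "integrable (distr (std_gauss_vec :: (real ^ 'd) measure) borel (\<lambda>z. z $ i)) f"
    unfolding distr_std_gauss_vec_nth by fact
  from integrable_distr[OF _ this] show ?thesis by simp
qed

text \<open>The squared norm t of phi_a(z) lies between (a |z_i|)^2, for any one coordinate i, and
  the sum of all squares. With \<open>ln_power4_le\<close> this leaves only one-dimensional Gaussian
  integrals, in every dimension d >= 1.\<close>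

lemma integrable_logsq_power4:
  assumes a: "0 < a" "a \<le> 1"
  shows "integrable std_gauss_vec (\<lambda>z::real ^ 'd. logsq a z ^ 4)"
proof (rule Bochner_Integration.integrable_bound)
  fix i :: 'd
  let ?g = "\<lambda>z::real ^ 'd. 256 * (\<Sum>j\<in>UNIV. (z $ j) ^ 2)
      + 65536 * a powr (-1/2) * \<bar>z $ i\<bar> powr (-1/2)"
  show "integrable std_gauss_vec ?g"
    by (intro Bochner_Integration.integrable_add integrable_mult_right Bochner_Integration.integrable_sum
        integrable_std_gauss_vec_nth[where f = "\<lambda>x. x ^ 2"]
        integrable_std_gauss_vec_nth[where f = "\<lambda>x. \<bar>x\<bar> powr (-1/2)"]
        integrable_std_normal_distribution_moment integrable_std_normal_inverse_sqrt)
  \<comment> \<open>Where z_i = 0 the singular term of the bound is 0 by convention and gives no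
    control, so this null set is removed.\<close>
  have "AE z in std_gauss_vec. (z :: real ^ 'd) $ i \<noteq> 0"
  proof -
    have "AE x in distr (std_gauss_vec :: (real ^ 'd) measure) borel (\<lambda>z. z $ i). x \<noteq> 0"
      unfolding distr_std_gauss_vec_nth by (subst AE_density) (auto intro: AE_mp[OF AE_lborel_singleton])
    then show ?thesis by (subst (asm) AE_distr_iff) auto
  qed
  then show "AE z in std_gauss_vec. norm (logsq a z ^ 4) \<le> norm (?g z)"
  proof eventually_elim
    case (elim z)
    define t where "t = (norm (prelu_vec a z))\<^sup>2"
    have "\<bar>z $ i\<bar> \<le> norm z" by (rule component_le_norm_cart)
    then have low: "a * \<bar>z $ i\<bar> \<le> norm (prelu_vec a z)"
      using norm_prelu_vec_ge[OF a, of z] a mult_left_mono[of "\<bar>z $ i\<bar>" "norm z" a] by linarith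
    have pos: "0 < a * \<bar>z $ i\<bar>" using elim a by simp
    then have t: "(a * \<bar>z $ i\<bar>)\<^sup>2 \<le> t" unfolding t_def using low by (intro power_mono) auto
    then have "0 < t" using pos by (smt (verit) zero_less_power)
    have "t powr (-1/4) \<le> ((a * \<bar>z $ i\<bar>)\<^sup>2) powr (-1/4)"
      using t pos by (intro powr_mono2') auto
    also have "\<dots> = (a * \<bar>z $ i\<bar>) powr (-1/2)"
      using pos by (simp add: powr_realpow[symmetric] powr_powr del: powr_numeral)
    also have "\<dots> = a powr (-1/2) * \<bar>z $ i\<bar> powr (-1/2)"
      using a by (simp add: powr_mult)
    finally have 1: "t powr (-1/4) \<le> a powr (-1/2) * \<bar>z $ i\<bar> powr (-1/2)" .
    have "t \<le> (norm z)\<^sup>2" unfolding t_def using norm_prelu_vec_le[OF a] by (intro power_mono) auto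
    also have "\<dots> = (\<Sum>j\<in>UNIV. (z $ j) ^ 2)"
      by (simp add: norm_vec_def L2_set_def sum_nonneg)
    finally have 2: "t \<le> (\<Sum>j\<in>UNIV. (z $ j) ^ 2)" .
    have "logsq a z ^ 4 \<le> ?g z"
      using ln_power4_le[OF \<open>0 < t\<close>] 1 2 unfolding logsq_def t_def[symmetric] by linarith
    then show ?case by (smt (verit) real_norm_def zero_le_even_power even_numeral)
  qed
qed simp

text \<open>A constant value m would confine almost every z to the ball of radius exp(m/2) / a,
  which has finite volume, while the whole space has infinite volume.\<close>

lemma logsq_not_AE_const:
  assumes a: "0 < a" "a \<le> 1"
  shows "\<not> (AE z in std_gauss_vec. logsq a (z :: real ^ 'd) = m)"
proof
  assume "AE z in std_gauss_vec. logsq a (z :: real ^ 'd) = m"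
  then have "AE z in lborel. logsq a (z :: real ^ 'd) = m"
    by (subst (asm) AE_std_gauss_vec_iff) auto
  then have "AE z in lborel. (z :: real ^ 'd) \<in> cball 0 (exp (m / 2) / a)"
    using AE_lborel_singleton[of 0]
  proof eventually_elim
    case (elim z)
    then have "0 < norm (prelu_vec a z)" using prelu_vec_eq_0_iff[OF a, of z] by simp
    moreover from this have "ln (norm (prelu_vec a z)) = m / 2"
      using elim by (simp add: logsq_def ln_realpow)
    ultimately have "norm (prelu_vec a z) = exp (m / 2)" by (metis exp_ln)
    then show ?case
      using norm_prelu_vec_ge[OF a, of z] a by (simp add: field_simps)
  qed
  then have "emeasure lborel (UNIV :: (real ^ 'd) set) = emeasure lborel (cball (0 :: real ^ 'd) (exp (m / 2) / a))"
    by (intro emeasure_eq_AE) auto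
  then show False using emeasure_lborel_cball_finite[of "0 :: real ^ 'd" "exp (m / 2) / a"] by simp
qed

text \<open>Zero variance would make \<open>logsq\<close> almost everywhere equal to its mean. The
  central limit theorem is applied with this variance and requires it to be positive.\<close>

lemma s2_a_pos:
  assumes a: "0 < a" "a \<le> 1"
  shows "0 < s2_a a TYPE('d::finite)"
proof -
  interpret prob_space "std_gauss_vec :: (real ^ 'd) measure" by (rule prob_space_std_gauss_vec)
  define m where "m = (\<integral>y. logsq a (y :: real ^ 'd) \<partial>std_gauss_vec)"
  have int: "integrable std_gauss_vec (\<lambda>z::real ^ 'd. logsq a z ^ k)" if "k \<le> 4" for k
    using integrable_power_of_fourth[OF _ integrable_logsq_power4[OF a] that] by simp
  have sq: "integrable std_gauss_vec (\<lambda>z::real ^ 'd. (logsq a z - m)\<^sup>2)"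
    using int[of 1] int[of 2] by (simp add: power2_diff)
  have "(\<integral>z. (logsq a z - m)\<^sup>2 \<partial>(std_gauss_vec :: (real ^ 'd) measure)) \<noteq> 0"
    using logsq_not_AE_const[OF a, where 'd = 'd, of m]
    by (subst integral_nonneg_eq_0_iff_AE[OF sq]) auto
  moreover have "0 \<le> (\<integral>z. (logsq a z - m)\<^sup>2 \<partial>(std_gauss_vec :: (real ^ 'd) measure))"
    by simp
  ultimately show ?thesis unfolding s2_a_def m_def by linarith
qed

section \<open>Layers and innovations\<close>

text \<open>The zero vector gets an arbitrary unit vector, so that the direction always has norm one.\<close>

definition direction :: "real ^ 'd \<Rightarrow> real ^ 'd" where
  "direction x = (if x = 0 then axis undefined 1 else (1 / norm x) *\<^sub>R x)"

lemma norm_direction: "norm (direction x) = 1"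
  by (simp add: direction_def)

lemma norm_scaleR_direction: "norm x *\<^sub>R direction x = x"
  by (simp add: direction_def)

lemma borel_measurable_direction [measurable]:
  "(direction :: real ^ 'd \<Rightarrow> _) \<in> borel_measurable borel"
  unfolding direction_def[abs_def] by measurable

lemma borel_measurable_matrix_vector_mult:
  fixes A :: "'a \<Rightarrow> real ^ 'd ^ 'd"
  assumes "\<And>i j. (\<lambda>\<omega>. A \<omega> $ i $ j) \<in> borel_measurable N" and [measurable]: "x \<in> borel_measurable N"
  shows "(\<lambda>\<omega>. A \<omega> *v x \<omega>) \<in> borel_measurable N"
proof (rule borel_measurable_vecI)
  fix i
  note [measurable] = assms(1)
  show "(\<lambda>\<omega>. (A \<omega> *v x \<omega>) $ i) \<in> borel_measurable N"
    by (simp add: matrix_vector_mult_def)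
qed

text \<open>Only weights with index below k are constrained, so the lemma also covers a layer
  rebuilt from the past entries alone, as a function on their product space.\<close>

lemma borel_measurable_layer:
  assumes "\<And>n i j. n < k \<Longrightarrow> (\<lambda>\<omega>. A n \<omega> $ i $ j) \<in> borel_measurable N"
  shows "(\<lambda>\<omega>. layer a (\<lambda>n. A n \<omega>) x0 k) \<in> borel_measurable N"
  using assms
proof (induction k)
  case (Suc k)
  then have "(\<lambda>\<omega>. A k \<omega> *v layer a (\<lambda>n. A n \<omega>) x0 k) \<in> borel_measurable N"
    by (intro borel_measurable_matrix_vector_mult) auto
  then show ?case by simp
qed simp

lemma layer_cong:
  assumes "\<And>n. n < k \<Longrightarrow> A n = B n"
  shows "layer a A x0 k = layer a B x0 k"
  using assms by (induction k) auto

text \<open>The vector G k of the overview, as a function of a deterministic sequence of matrices.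
  It can thus be evaluated both on the random weights and on matrices rebuilt from a restricted
  family of entries.\<close>

definition innovation ::
    "real \<Rightarrow> real \<Rightarrow> real ^ 'd \<Rightarrow> (nat \<Rightarrow> real ^ 'd ^ 'd) \<Rightarrow> nat \<Rightarrow> real ^ 'd" where
  "innovation a \<sigma> x0 A k = (1 / \<sigma>) *\<^sub>R (A k *v direction (layer a A x0 k))"

lemma borel_measurable_innovation:
  assumes "\<And>n i j. n \<le> k \<Longrightarrow> (\<lambda>\<omega>. A n \<omega> $ i $ j) \<in> borel_measurable N"
  shows "(\<lambda>\<omega>. innovation a \<sigma> x0 (\<lambda>n. A n \<omega>) k) \<in> borel_measurable N"
  unfolding innovation_def
  by (intro borel_measurable_scaleR borel_measurable_const borel_measurable_matrix_vector_mult
      measurable_compose[OF borel_measurable_layer borel_measurable_direction] assms) auto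

lemma innovation_cong:
  assumes "\<And>n. n \<le> k \<Longrightarrow> A n = B n"
  shows "innovation a \<sigma> x0 A k = innovation a \<sigma> x0 B k"
  using layer_cong[of k A B a x0] assms by (simp add: innovation_def)

lemma layer_Suc_innovation:
  assumes "0 < \<sigma>"
  shows "layer a A x0 (Suc k)
    = (norm (layer a A x0 k) * \<sigma>) *\<^sub>R prelu_vec a (innovation a \<sigma> x0 A k)"
proof -
  let ?x = "layer a A x0 k"
  have "A k *v ?x = A k *v (norm ?x *\<^sub>R direction ?x)" by (simp add: norm_scaleR_direction)
  also have "\<dots> = (norm ?x * \<sigma>) *\<^sub>R innovation a \<sigma> x0 A k"
    using assms by (simp add: innovation_def matrix_vector_mult_scaleR)
  finally show ?thesis using assms by (simp add: prelu_vec_scaleR)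
qed

lemma layer_nonzero:
  assumes "0 < \<sigma>" "0 < a" "a \<le> 1" "x0 \<noteq> 0" "\<And>i. i < k \<Longrightarrow> innovation a \<sigma> x0 A i \<noteq> 0"
  shows "layer a A x0 k \<noteq> 0"
  using assms(5)
proof (induction k)
  case (Suc k)
  then show ?case
    unfolding layer_Suc_innovation[OF assms(1)] using assms by (simp add: prelu_vec_eq_0_iff)
qed (simp add: assms)

lemma ln_norm_layer:
  assumes \<sigma>: "0 < \<sigma>" and a: "0 < a" "a \<le> 1" and x0: "x0 \<noteq> 0"
    and nz: "\<And>i. i < k \<Longrightarrow> innovation a \<sigma> x0 A i \<noteq> 0"
  shows "ln (norm (layer a A x0 k))
    = ln (norm x0) + real k * ln \<sigma> + (\<Sum>i<k. logsq a (innovation a \<sigma> x0 A i) / 2)"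
  using nz
proof (induction k)
  case (Suc k)
  \<comment> \<open>\<open>ln 0\<close> is 0, so the logarithm of the product splits only for
    nonzero factors.\<close>
  have 1: "layer a A x0 k \<noteq> 0" using Suc.prems by (intro layer_nonzero[OF \<sigma> a x0]) auto
  have 2: "prelu_vec a (innovation a \<sigma> x0 A k) \<noteq> 0"
    using Suc.prems by (simp add: prelu_vec_eq_0_iff[OF a])
  have "ln (norm (layer a A x0 (Suc k)))
      = ln (norm (layer a A x0 k)) + ln \<sigma> + logsq a (innovation a \<sigma> x0 A k) / 2"
    unfolding layer_Suc_innovation[OF \<sigma>] using 1 2 \<sigma>
    by (simp add: ln_mult ln_realpow logsq_def)
  then show ?case using Suc by (simp add: algebra_simps del: layer.simps)
qed simp

section \<open>The random network and the independence of its innovations\<close>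

locale gaussian_network = prob_space M
  for M :: "'a measure" +
  fixes W :: "nat \<Rightarrow> 'a \<Rightarrow> real ^ 'd ^ 'd" and \<sigma> a :: real and x0 :: "real ^ 'd"
  assumes \<sigma>: "0 < \<sigma>" and a: "0 < a" "a \<le> 1" and x0: "x0 \<noteq> 0"
    and indep_entries: "indep_vars (\<lambda>_. borel) (\<lambda>(k, i, j) \<omega>. W k \<omega> $ i $ j) UNIV"
    and normal_entries: "\<And>k i j. distributed M lborel (\<lambda>\<omega>. W k \<omega> $ i $ j) (normal_density 0 \<sigma>)"
begin

abbreviation G :: "nat \<Rightarrow> 'a \<Rightarrow> real ^ 'd" where
  "G k \<omega> \<equiv> innovation a \<sigma> x0 (\<lambda>n. W n \<omega>) k"

lemma rv_entry [measurable]: "(\<lambda>\<omega>. W k \<omega> $ i $ j) \<in> borel_measurable M"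
  using normal_entries[of k i j] by (auto simp: distributed_def)

lemma rv_innovation [measurable]: "random_variable borel (G k)"
  by (rule borel_measurable_innovation) simp

lemma rv_layer [measurable]: "random_variable borel (\<lambda>\<omega>. layer a (\<lambda>n. W n \<omega>) x0 k)"
  by (rule borel_measurable_layer) simp

text \<open>The case expression is applied to the sample point from outside, which is the shape that
  restricting \<open>indep_entries\<close> to a block of indices produces.\<close>

abbreviation entries :: "'a \<Rightarrow> nat \<times> 'd \<times> 'd \<Rightarrow> real" where
  "entries \<omega> p \<equiv> (case p of (k, i, j) \<Rightarrow> \<lambda>\<omega>. W k \<omega> $ i $ j) \<omega>"

text \<open>Turns a family of scalars back into matrices, so that layers and innovations become
  functions on the product space of a block of entries.\<close>

abbreviation weight :: "(nat \<times> 'd \<times> 'd \<Rightarrow> real) \<Rightarrow> nat \<Rightarrow> real ^ 'd ^ 'd" where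
  "weight f k \<equiv> (\<chi> i j. f (k, i, j))"

lemma weight_restrict:
  assumes "{k} \<times> UNIV \<subseteq> I"
  shows "weight (restrict (entries \<omega>) I) k = W k \<omega>"
  using assms by (auto simp: vec_eq_iff restrict_def)

lemma distr_weight_mult_unit:
  assumes "norm u = 1"
  shows "distr M borel (\<lambda>\<omega>. (1 / \<sigma>) *\<^sub>R (W k \<omega> *v u)) = std_gauss_vec"
proof (rule distr_gauss_matrix_mult_unit)
  have "indep_vars (\<lambda>p. PiM {(k, p)} (\<lambda>_. borel)) (\<lambda>p \<omega>. restrict (entries \<omega>) {(k, p)}) (UNIV :: ('d \<times> 'd) set)"
    by (rule indep_vars_restrict[OF indep_entries]) (auto simp: disjoint_family_on_def)
  then have "indep_vars (\<lambda>_. borel)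
      (\<lambda>p \<omega>. (\<lambda>f. f (k, p)) (restrict (entries \<omega>) {(k, p)})) (UNIV :: ('d \<times> 'd) set)"
    by (rule indep_vars_compose2) auto
  then show "indep_vars (\<lambda>_. borel) (\<lambda>(i, j) \<omega>. W k \<omega> $ i $ j) UNIV"
    by (simp add: case_prod_unfold)
qed (fact normal_entries \<sigma> assms)+

text \<open>The entries before layer k and those of layer k form independent blocks. For a frozen
  past, G k is the matrix of layer k applied to a fixed unit vector, hence standard Gaussian, and
  \<open>indep_var_law_constant\<close> applies.\<close>

lemma innovation_independent_of_past:
  shows "distr M borel (G k) = std_gauss_vec"
    and "E \<in> sets (PiM {..<k} (\<lambda>_. borel)) \<Longrightarrow> B \<in> sets borel \<Longrightarrow>
      prob (((\<lambda>\<omega>. \<lambda>j\<in>{..<k}. G j \<omega>) -` E \<inter> space M) \<inter> (G k -` B \<inter> space M))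
      = prob ((\<lambda>\<omega>. \<lambda>j\<in>{..<k}. G j \<omega>) -` E \<inter> space M) * prob (G k -` B \<inter> space M)"
proof -
  define I where "I = {..<k} \<times> (UNIV :: ('d \<times> 'd) set)"
  define J where "J = {k} \<times> (UNIV :: ('d \<times> 'd) set)"
  let ?S = "PiM I (\<lambda>_. borel :: real measure)" and ?T = "PiM J (\<lambda>_. borel :: real measure)"
  let ?X = "\<lambda>\<omega>. restrict (entries \<omega>) I" and ?V = "\<lambda>\<omega>. restrict (entries \<omega>) J"
  define f where "f x v = (1 / \<sigma>) *\<^sub>R (weight v k *v direction (layer a (weight x) x0 k))" for x v
  have indep: "indep_var ?S ?X ?T ?V"
    by (rule indep_var_restrict[OF indep_entries]) (auto simp: I_def J_def)
  have weight_X: "weight (?X \<omega>) n = W n \<omega>" if "n < k" for n \<omega>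
    using that by (intro weight_restrict) (auto simp: I_def)
  have weight_V: "weight (?V \<omega>) k = W k \<omega>" for \<omega>
    by (intro weight_restrict) (auto simp: J_def)
  have f_XV: "f (?X \<omega>) (?V \<omega>) = G k \<omega>" for \<omega>
  proof -
    have "layer a (weight (?X \<omega>)) x0 k = layer a (\<lambda>n. W n \<omega>) x0 k"
      by (rule layer_cong) (simp only: weight_X)
    then show ?thesis unfolding f_def innovation_def weight_V by simp
  qed
  have meas: "(\<lambda>(x, v). f x v) \<in> ?S \<Otimes>\<^sub>M ?T \<rightarrow>\<^sub>M borel"
    unfolding f_def case_prod_beta
    by (intro borel_measurable_scaleR borel_measurable_const borel_measurable_matrix_vector_mult
        measurable_compose[OF borel_measurable_layer borel_measurable_direction])
      (auto simp: I_def J_def intro!: measurable_compose[OF measurable_fst measurable_component_singleton]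
        measurable_compose[OF measurable_snd measurable_component_singleton])
  \<comment> \<open>This holds for every family x, including those whose layer vanishes, since
    \<open>direction\<close> always has norm one.\<close>
  have law: "distr M borel (\<lambda>\<omega>. f x (?V \<omega>)) = std_gauss_vec" for x
    unfolding f_def weight_V by (rule distr_weight_mult_unit) (rule norm_direction)
  note main = indep_var_law_constant[where f = f, OF indep meas, of std_gauss_vec, OF law]
  show "distr M borel (G k) = std_gauss_vec" using main(2) unfolding f_XV .
  assume E: "E \<in> sets (PiM {..<k} (\<lambda>_. borel))" and B: "B \<in> sets borel"
  \<comment> \<open>The earlier innovations are a function of the past entries, so every event about
    them is an event about X.\<close>
  define h where "h x = (\<lambda>j\<in>{..<k}. innovation a \<sigma> x0 (weight x) j)" for x
  have "h \<in> ?S \<rightarrow>\<^sub>M PiM {..<k} (\<lambda>_. borel)"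
    unfolding h_def
    by (intro measurable_restrict borel_measurable_innovation) (auto simp: I_def)
  then have A: "h -` E \<inter> space ?S \<in> sets ?S" using E by (rule measurable_sets)
  have h: "h (?X \<omega>) = (\<lambda>j\<in>{..<k}. G j \<omega>)" for \<omega>
    unfolding h_def by (intro restrict_ext innovation_cong weight_X) auto
  have "?X \<omega> \<in> space ?S" for \<omega> by (simp add: space_PiM)
  then have "?X -` (h -` E \<inter> space ?S) \<inter> space M = (\<lambda>\<omega>. \<lambda>j\<in>{..<k}. G j \<omega>) -` E \<inter> space M"
    by (auto simp: h)
  with main(1)[OF A B, unfolded f_XV]
  show "prob (((\<lambda>\<omega>. \<lambda>j\<in>{..<k}. G j \<omega>) -` E \<inter> space M) \<inter> (G k -` B \<inter> space M))
      = prob ((\<lambda>\<omega>. \<lambda>j\<in>{..<k}. G j \<omega>) -` E \<inter> space M) * prob (G k -` B \<inter> space M)"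
    by simp
qed

lemma indep_innovations: "indep_vars (\<lambda>_. borel) G UNIV"
  by (rule indep_vars_of_past[OF rv_innovation innovation_independent_of_past(2)])

lemma AE_innovations_nonzero: "AE \<omega> in M. \<forall>k. G k \<omega> \<noteq> 0"
proof -
  have "AE \<omega> in M. G k \<omega> \<noteq> 0" for k
  proof -
    have "AE z in distr M borel (G k). z \<noteq> 0"
      unfolding innovation_independent_of_past(1) by (rule AE_std_gauss_vec_nonzero)
    then show ?thesis by (subst (asm) AE_distr_iff) auto
  qed
  then show ?thesis by (simp add: AE_all_countable)
qed

text \<open>The halving reflects that ln of the norm is half of \<open>logsq\<close>; the removed
  mean, together with ln \<sigma>, makes up the drift \<open>mu_a\<close>.\<close>

definition increment :: "nat \<Rightarrow> 'a \<Rightarrow> real" where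
  "increment k \<omega> = (logsq a (G k \<omega>) - (\<integral>y. logsq a (y :: real ^ 'd) \<partial>std_gauss_vec)) / 2"

lemma rv_increment [measurable]: "random_variable borel (increment k)"
  unfolding increment_def[abs_def] by measurable

lemma indep_increments: "indep_vars (\<lambda>_. borel) increment UNIV"
  unfolding increment_def[abs_def] by (rule indep_vars_compose2[OF indep_innovations]) measurable

lemma increment_law:
  fixes g :: "real \<Rightarrow> real"
  assumes [measurable]: "g \<in> borel_measurable borel"
  defines "m \<equiv> \<integral>y. logsq a (y :: real ^ 'd) \<partial>std_gauss_vec"
  shows "integrable M (\<lambda>\<omega>. g (increment k \<omega>))
      \<longleftrightarrow> integrable std_gauss_vec (\<lambda>z::real ^ 'd. g ((logsq a z - m) / 2))"
    and "expectation (\<lambda>\<omega>. g (increment k \<omega>)) = (\<integral>z. g ((logsq a (z :: real ^ 'd) - m) / 2) \<partial>std_gauss_vec)"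
proof -
  have eq: "increment k \<omega> = (logsq a (G k \<omega>) - m) / 2" for \<omega> by (simp add: increment_def m_def)
  have [measurable]: "(\<lambda>z::real ^ 'd. g ((logsq a z - m) / 2)) \<in> borel_measurable borel" by simp
  show "integrable M (\<lambda>\<omega>. g (increment k \<omega>))
      \<longleftrightarrow> integrable std_gauss_vec (\<lambda>z::real ^ 'd. g ((logsq a z - m) / 2))"
    unfolding eq innovation_independent_of_past(1)[of k, symmetric] by (subst integrable_distr_eq) auto
  show "expectation (\<lambda>\<omega>. g (increment k \<omega>)) = (\<integral>z. g ((logsq a (z :: real ^ 'd) - m) / 2) \<partial>std_gauss_vec)"
    unfolding eq innovation_independent_of_past(1)[of k, symmetric] by (subst integral_distr) auto
qed

lemma integrable_logsq_power:
  assumes "k \<le> 4"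
  shows "integrable std_gauss_vec (\<lambda>z::real ^ 'd. logsq a z ^ k)"
proof -
  interpret S: prob_space "std_gauss_vec :: (real ^ 'd) measure" by (rule prob_space_std_gauss_vec)
  show ?thesis
    using S.integrable_power_of_fourth[OF _ integrable_logsq_power4[OF a] assms] by simp
qed

lemma increment_moments:
  shows "expectation (increment k) = 0"
    and "integrable M (\<lambda>\<omega>. increment k \<omega> ^ 4)"
    and "expectation (\<lambda>\<omega>. increment k \<omega> ^ 4) = expectation (\<lambda>\<omega>. increment 0 \<omega> ^ 4)"
    and "integrable M (\<lambda>\<omega>. (increment k \<omega>)\<^sup>2)"
    and "expectation (\<lambda>\<omega>. (increment k \<omega>)\<^sup>2) = s2_a a TYPE('d)"
proof -
  interpret S: prob_space "std_gauss_vec :: (real ^ 'd) measure" by (rule prob_space_std_gauss_vec)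
  let ?m = "\<integral>y. logsq a (y :: real ^ 'd) \<partial>std_gauss_vec"
  note int = integrable_logsq_power
  show "expectation (increment k) = 0"
    using increment_law(2)[of "\<lambda>x. x" k] int[of 1] by (simp add: S.prob_space[simplified])
  have expand: "((logsq a (z :: real ^ 'd) - ?m) / 2) ^ 4 = (logsq a z ^ 4 - 4 * ?m * logsq a z ^ 3
      + 6 * ?m ^ 2 * logsq a z ^ 2 - 4 * ?m ^ 3 * logsq a z ^ 1 + ?m ^ 4) / 16" for z
    by (simp add: field_simps eval_nat_numeral)
  have "integrable std_gauss_vec (\<lambda>z::real ^ 'd. ((logsq a z - ?m) / 2) ^ 4)"
    unfolding expand using int[of 1] int[of 2] int[of 3] int[of 4] by simp
  then show 4: "integrable M (\<lambda>\<omega>. increment k \<omega> ^ 4)"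
    by (subst increment_law(1)) auto
  show "expectation (\<lambda>\<omega>. increment k \<omega> ^ 4) = expectation (\<lambda>\<omega>. increment 0 \<omega> ^ 4)"
    using increment_law(2)[of "\<lambda>x. x ^ 4"] by simp
  show "integrable M (\<lambda>\<omega>. (increment k \<omega>)\<^sup>2)"
    by (rule integrable_power_of_fourth[OF rv_increment 4]) simp
  show "expectation (\<lambda>\<omega>. (increment k \<omega>)\<^sup>2) = s2_a a TYPE('d)"
    by (subst increment_law(2)) (simp_all add: s2_a_def power_divide)
qed

lemma distr_increment: "distr M borel (increment k) = distr M borel (increment 0)"
proof -
  have "distr M borel (increment k)
      = distr (distr M borel (G k)) borel (\<lambda>z. (logsq a z - (\<integral>y. logsq a (y :: real ^ 'd) \<partial>std_gauss_vec)) / 2)" for k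
    by (subst distr_distr) (auto simp: comp_def increment_def[abs_def])
  then show ?thesis by (simp add: innovation_independent_of_past(1))
qed

lemma AE_ln_norm_layer:
  "AE \<omega> in M. \<forall>k. ln (norm (layer a (\<lambda>n. W n \<omega>) x0 k))
    = ln (norm x0) + mu_a a \<sigma> TYPE('d) * real k + (\<Sum>i<k. increment i \<omega>)"
  using AE_innovations_nonzero
proof eventually_elim
  case (elim \<omega>)
  show ?case
  proof
    fix k
    show "ln (norm (layer a (\<lambda>n. W n \<omega>) x0 k))
        = ln (norm x0) + mu_a a \<sigma> TYPE('d) * real k + (\<Sum>i<k. increment i \<omega>)"
      using ln_norm_layer[OF \<sigma> a x0, of k "\<lambda>n. W n \<omega>"] elim
      by (simp add: mu_a_def increment_def sum_divide_distrib[symmetric] sum_subtractf field_simps)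
  qed
qed

section \<open>Almost sure growth rate and Gaussian fluctuations of the logarithmic norm\<close>

lemma lyapunov_limit:
  "AE \<omega> in M. (\<lambda>k. ln (norm (layer a (\<lambda>n. W n \<omega>) x0 k)) / real k) \<longlonglongrightarrow> mu_a a \<sigma> TYPE('d)"
proof -
  have "AE \<omega> in M. (\<lambda>n. (\<Sum>i<n. increment i \<omega>) / real n) \<longlonglongrightarrow> 0"
    by (rule strong_law_of_fourth_moments[OF indep_increments increment_moments(1,2)])
      (rule eq_refl[OF increment_moments(3)])
  then show ?thesis
    using AE_ln_norm_layer
  proof eventually_elim
    case (elim \<omega>)
    let ?\<mu> = "mu_a a \<sigma> TYPE('d)"
    have "(\<lambda>k. ln (norm x0) / real k + ?\<mu> + (\<Sum>i<k. increment i \<omega>) / real k) \<longlonglongrightarrow> 0 + ?\<mu> + 0"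
      by (rule tendsto_add[OF tendsto_add[OF lim_const_over_n tendsto_const] elim(1)])
    \<comment> \<open>At k = 0 division by zero makes the left side equal to the drift and the right
      side 0, so the identity is claimed only eventually.\<close>
    moreover have "\<forall>\<^sub>F k in sequentially. ln (norm x0) / real k + ?\<mu> + (\<Sum>i<k. increment i \<omega>) / real k
        = ln (norm (layer a (\<lambda>n. W n \<omega>) x0 k)) / real k"
      using eventually_gt_at_top[of 0] by eventually_elim (simp add: elim(2) field_simps)
    ultimately show ?case by (simp add: Lim_transform_eventually)
  qed
qed

text \<open>The normalised logarithm is s times the standardised random walk plus ln ||x0|| / sqrt
  n, a deterministic shift that tends to 0.\<close>

lemma lyapunov_clt:
  "weak_conv_m
    (\<lambda>k. distr M borel (\<lambda>\<omega>. (ln (norm (layer a (\<lambda>n. W n \<omega>) x0 k)) - mu_a a \<sigma> TYPE('d) * real k)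
                             / sqrt (real k)))
    (density lborel (normal_density 0 (sqrt (s2_a a TYPE('d)))))"
proof -
  define s where "s = sqrt (s2_a a TYPE('d))"
  have s: "0 < s" "s\<^sup>2 = s2_a a TYPE('d)" using s2_a_pos[OF a, where 'd = 'd] by (simp_all add: s_def)
  let ?Z = "\<lambda>n \<omega>. (\<Sum>i<n. increment i \<omega>) / sqrt (real n * s\<^sup>2)"
  let ?c = "\<lambda>n. ln (norm x0) / sqrt (real n)"
  have clt: "weak_conv_m (\<lambda>n. distr M borel (?Z n)) std_normal_distribution"
    by (rule central_limit_theorem_zero_mean[OF indep_increments increment_moments(1) s(1)
          increment_moments(4) _ distr_increment])
      (simp add: increment_moments(1,5) s(2))
  have "?c \<longlonglongrightarrow> 0"
    by (intro tendsto_divide_0[OF tendsto_const] filterlim_at_top_imp_at_infinity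
        filterlim_compose[OF sqrt_at_top filterlim_real_sequentially])
  with clt s(1) have "weak_conv_m (\<lambda>n. distr M borel (\<lambda>\<omega>. ?c n + s * ?Z n \<omega>)) (density lborel (normal_density 0 s))"
    by (intro weak_conv_m_affine_std_normal) auto
  \<comment> \<open>The random walk formula holds only almost everywhere, which suffices for
    equality of laws. At n = 0 all quotients are 0.\<close>
  moreover have "distr M borel (\<lambda>\<omega>. ?c n + s * ?Z n \<omega>)
      = distr M borel (\<lambda>\<omega>. (ln (norm (layer a (\<lambda>n. W n \<omega>) x0 n)) - mu_a a \<sigma> TYPE('d) * real n) / sqrt (real n))" for n
  proof (rule distr_cong_AE)
    show "AE \<omega> in M. ?c n + s * ?Z n \<omega>
        = (ln (norm (layer a (\<lambda>n. W n \<omega>) x0 n)) - mu_a a \<sigma> TYPE('d) * real n) / sqrt (real n)"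
      using AE_ln_norm_layer
    proof eventually_elim
      case (elim \<omega>)
      have "s * ?Z n \<omega> = (\<Sum>i<n. increment i \<omega>) / sqrt (real n)"
        using s(1) by (simp add: real_sqrt_mult)
      then show ?case using elim by (simp add: add_divide_distrib)
    qed
  qed auto
  ultimately show ?thesis by (simp add: s_def)
qed

end

theorem mainTheorem8:
  fixes M :: "'a measure" and W :: "nat \<Rightarrow> 'a \<Rightarrow> real ^ 'd ^ 'd"
    and \<sigma> a :: real and x0 :: "real ^ 'd"
  assumes "prob_space M"
    and "\<sigma> > 0"
    and "0 < a" and "a \<le> 1"
    and "x0 \<noteq> 0"
    and "prob_space.indep_vars M (\<lambda>_. borel) (\<lambda>(k, i, j) \<omega>. W k \<omega> $ i $ j) UNIV"
    and "\<And>k i j. distributed M lborel (\<lambda>\<omega>. W k \<omega> $ i $ j) (normal_density 0 \<sigma>)"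
  shows "(\<forall>k. AE \<omega> in M. layer a (\<lambda>n. W n \<omega>) x0 k \<noteq> 0)
    \<and> integrable std_gauss_vec (\<lambda>z::real ^ 'd. logsq a z)
    \<and> integrable std_gauss_vec (\<lambda>z::real ^ 'd. (logsq a z)\<^sup>2)
    \<and> (AE \<omega> in M. (\<lambda>k. ln (norm (layer a (\<lambda>n. W n \<omega>) x0 k)) / real k)
          \<longlonglongrightarrow> mu_a a \<sigma> TYPE('d))
    \<and> weak_conv_m
        (\<lambda>k. distr M borel (\<lambda>\<omega>. (ln (norm (layer a (\<lambda>n. W n \<omega>) x0 k)) - mu_a a \<sigma> TYPE('d) * real k)
                                 / sqrt (real k)))
        (density lborel (normal_density 0 (sqrt (s2_a a TYPE('d)))))"
proof -
  interpret gaussian_network M W \<sigma> a x0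
    using assms unfolding gaussian_network_def gaussian_network_axioms_def by blast
  have "AE \<omega> in M. layer a (\<lambda>n. W n \<omega>) x0 k \<noteq> 0" for k
    using AE_innovations_nonzero by eventually_elim (rule layer_nonzero[OF \<sigma> a x0], simp)
  then show ?thesis
    using integrable_logsq_power[of 1] integrable_logsq_power[of 2] lyapunov_limit lyapunov_clt by simp
qed

end
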